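(* Let $\mathbb{F}$ be a field and $n$ a positive integer. For any $A_1,A_2,A_3\in M_n$, \begin{align*} S_2(A_1+A_2)={}&S_2(A_1)+S_2(A_2)+S_1(A_1)S_1(A_2)-S_1(A_1A_2),\\[2mm] S_3(A_1+A_2)={}&S_3(A_1)+S_3(A_2)-S_1(A_1+A_2)S_1(A_1A_2)+S_1(A_1)S_2(A_2)\\ &+S_1(A_2)S_2(A_1)+S_1(A_1^2A_2)+S_1(A_1A_2^2),\\[2mm] S_3(A_1+A_2+A_3)={}&S_3(A_1)+S_3(A_2)+S_3(A_3)\\ &-S_1(A_1+A_2+A_3)\,S_1(A_1A_2+A_1A_3+A_2A_3)\\ &+S_1(A_1)\big(S_2(A_2)+S_2(A_3)\big)+S_1(A_2)\big(S_2(A_1)+S_2(A_3)\big)\\ &+S_1(A_3)\big(S_2(A_1)+S_2(A_2)\big)\\ &+S_1(A_1^2A_2)+S_1(A_1A_2^2)+S_1(A_1^2A_3)+S_1(A_1A_3^2)\\ &+S_1(A_2^2A_3)+S_1(A_2A_3^2)+S_1(A_1A_2A_3)+S_1(A_1A_3A_2). \end{align*}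
   Context: $M_n$ denotes the set of $n\times n$ matrices over an arbitrary field $\mathbb{F}$. For $C\in M_n$, $S_k(C)$ is the $k$-th elementary symmetric function of $C$, defined by $\det(tI-C)=t^n-S_1(C)t^{n-1}+\cdots+(-1)^nS_n(C)$; equivalently $S_k(C)=\sum_{|\alpha|=k}\det(C(\alpha,\alpha))$, the sum over index sets $\alpha\subseteq\{1,\dots,n\}$ of size $k$, where $C(\alpha,\alpha)$ is the submatrix of $C$ in the rows and columns indexed by $\alpha$. In particular $S_1$ is the trace. By convention $S_k(C)=0$ for $k>n$.
   Formalization: The third identity is false as printed (for n=1 and A_1=A_2=A_3=(1) the left side is 0, the right side -1); the formal statement adds the missing term S_1(A_1)S_1(A_2)S_1(A_3) to its right-hand side. *)

theory Defs
  imports "Jordan_Normal_Form.Char_Poly"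
begin

text \<open>The \<open>k\<close>-th elementary symmetric function of an \<open>n \<times> n\<close> matrix, read off from
  \<open>det (t I - C) = t ^ n - S 1 C * t ^ (n - 1) + \<dots> + (- 1) ^ n * S n C\<close>.
  The case distinction is needed because \<open>n - k\<close> is truncated subtraction; it makes
  \<open>S k C = 0\<close> for \<open>k > n\<close>. Meaningful for square matrices only.\<close>

definition S :: "nat \<Rightarrow> 'a :: comm_ring_1 mat \<Rightarrow> 'a" where
  "S k C = (if k \<le> dim_row C then (- 1) ^ k * coeff (char_poly C) (dim_row C - k) else 0)"

text \<open>The source formula for \<open>S 3 (A1 + A2 + A3)\<close> omits the trilinear term
  \<open>S 1 A1 * S 1 A2 * S 1 A3\<close>. Without it the formula fails over every field: for three
  \<open>1 \<times> 1\<close> matrices with entry \<open>1\<close> the left-hand side is \<open>0\<close> and the right-hand side is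
  \<open>- 1\<close>. The statement formalized here includes the missing term.\<close>

end

theory Submission
  imports Defs
begin

text \<open>The elementary symmetric function \<open>S k\<close> is a homogeneous polynomial of degree \<open>k\<close> in the
  matrix entries, and the identities say what its mixed parts are. In characteristic zero they
  follow from Newton's identities by polarization; that route divides by \<open>2\<close> and \<open>6\<close>, so over an
  arbitrary field the argument works with minors instead.

  \<open>S k C\<close> is the sum of the principal \<open>k \<times> k\<close> minors of \<open>C\<close> (\<open>S_eq_sum_principal_minors\<close>). For
  \<open>C = A + B\<close> each minor expands by multilinearity into minors that mix rows of \<open>A\<close> and of \<open>B\<close>.
  A mixed minor with one distinguished row \<open>p\<close> makes sense for every \<open>p\<close> and vanishes if \<open>p\<close>
  equals another row index. Therefore the sum over increasing index tuples and over the position of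
  the distinguished row equals a sum in which \<open>p\<close> is unrestricted (\<open>sum_pairs_symmetrize\<close>,
  \<open>sum_triples_distinguish\<close>). Expanding along that row leaves products of traces and \<open>S 2\<close>
  (\<open>sum_det3_row\<close>), without any division. For \<open>k = 3\<close> this shows that the part of
  \<open>S 3 (A + B)\<close> linear in \<open>B\<close> is \<open>S 1 B * S 2 A - S 1 A * S 1 (A * B) + S 1 (A ^\<^sub>m 2 * B)\<close>.

  The formula for three summands is the one for two summands applied to \<open>(A + B) + C\<close>, together
  with linearity and cyclic invariance of the trace \<open>S 1\<close>.\<close>

section \<open>Elementary symmetric functions as sums of principal minors\<close>

text \<open>The inner sum is the Leibniz formula for the principal minor of \<open>C\<close> on \<open>\<alpha>\<close>. In
  the Leibniz expansion of \<open>det (t I - C)\<close>, the product belonging to \<open>p\<close> is multiplied out by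
  choosing the set \<open>\<alpha>\<close> of rows that contribute an entry of \<open>- C\<close>; the remaining rows contribute
  an entry of \<open>t I\<close>, which vanishes unless \<open>p\<close> fixes them. So exactly the pairs in which \<open>p\<close>
  permutes \<open>\<alpha>\<close> survive, and such a pair contributes to the power \<open>t ^ (n - card \<alpha>)\<close> alone.\<close>

lemma S_eq_sum_principal_minors:
  assumes C: "C \<in> carrier_mat n n"
  shows "S k C = (\<Sum>\<alpha> | \<alpha> \<subseteq> {0..<n} \<and> card \<alpha> = k.
    \<Sum>p | p permutes \<alpha>. signof p * (\<Prod>i\<in>\<alpha>. C $$ (i, p i)))"
proof (cases "k \<le> n")
  case False
  have "\<not> (\<alpha> \<subseteq> {0..<n} \<and> card \<alpha> = k)" for \<alpha>
    using card_mono[of "{0..<n}" \<alpha>] False by auto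
  then have "{\<alpha>. \<alpha> \<subseteq> {0..<n} \<and> card \<alpha> = k} = {}" by blast
  then show ?thesis using False C by (simp add: S_def del: Collect_empty_eq)
next
  case True
  let ?U = "{0..<n}"
  have M: "char_poly_matrix C \<in> carrier_mat n n" using C by simp
  have term_coeff: "coeff (\<Prod>i = 0..<n. char_poly_matrix C $$ (i, p i)) (n - k) =
      (\<Sum>\<alpha> | \<alpha> \<subseteq> ?U \<and> card \<alpha> = k. if p permutes \<alpha>
        then (- 1) ^ k * (\<Prod>i\<in>\<alpha>. C $$ (i, p i)) else 0)"
    if p: "p permutes ?U" for p
  proof -
    let ?d = "\<lambda>i. if p i = i then [:0, 1:] else (0 :: 'a poly)"
    have fix_outside: "(\<forall>i\<in>?U - \<alpha>. p i = i) \<longleftrightarrow> p permutes \<alpha>" if "\<alpha> \<subseteq> ?U" for \<alpha>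
      using p that permutes_superset[OF p, of \<alpha>] permutes_not_in[of p \<alpha>] by auto
    have "(\<Prod>i = 0..<n. char_poly_matrix C $$ (i, p i))
        = (\<Prod>i = 0..<n. [:- C $$ (i, p i):] + ?d i)"
      using C permutes_in_image[OF p] by (intro prod.cong) (auto simp: char_poly_matrix_def)
    also have "\<dots> = (\<Sum>\<alpha>\<in>Pow ?U. (\<Prod>i\<in>\<alpha>. [:- C $$ (i, p i):]) * (\<Prod>i\<in>?U - \<alpha>. ?d i))"
      by (rule prod_add) simp
    also have "\<dots> = (\<Sum>\<alpha>\<in>Pow ?U. if p permutes \<alpha>
        then monom ((- 1) ^ card \<alpha> * (\<Prod>i\<in>\<alpha>. C $$ (i, p i))) (n - card \<alpha>) else 0)"
    proof (rule sum.cong[OF refl])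
      fix \<alpha> assume "\<alpha> \<in> Pow ?U"
      then have sub: "\<alpha> \<subseteq> ?U" and fin: "finite \<alpha>" using finite_subset by auto
      have "(\<Prod>i\<in>\<alpha>. [:- C $$ (i, p i):]) = [:\<Prod>i\<in>\<alpha>. - C $$ (i, p i):]"
        by (induction \<alpha> rule: infinite_finite_induct) auto
      also have "(\<Prod>i\<in>\<alpha>. - C $$ (i, p i)) = (- 1) ^ card \<alpha> * (\<Prod>i\<in>\<alpha>. C $$ (i, p i))"
        using fin by (induction \<alpha> rule: finite_induct) auto
      finally have 1: "(\<Prod>i\<in>\<alpha>. [:- C $$ (i, p i):])
        = [:(- 1) ^ card \<alpha> * (\<Prod>i\<in>\<alpha>. C $$ (i, p i)):]" .
      show "(\<Prod>i\<in>\<alpha>. [:- C $$ (i, p i):]) * (\<Prod>i\<in>?U - \<alpha>. ?d i) = (if p permutes \<alpha>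
        then monom ((- 1) ^ card \<alpha> * (\<Prod>i\<in>\<alpha>. C $$ (i, p i))) (n - card \<alpha>) else 0)"
      proof (cases "p permutes \<alpha>")
        case True
        then have "(\<Prod>i\<in>?U - \<alpha>. ?d i) = (\<Prod>i\<in>?U - \<alpha>. [:0, 1:])"
          using fix_outside[OF sub] by (intro prod.cong) auto
        also have "\<dots> = monom 1 (n - card \<alpha>)"
          using sub fin by (simp add: card_Diff_subset x_as_monom monom_power)
        finally show ?thesis using True 1 by (simp add: smult_monom)
      next
        case False
        then obtain i where "i \<in> ?U - \<alpha>" "p i \<noteq> i" using fix_outside[OF sub] by blast
        then have "(\<Prod>i\<in>?U - \<alpha>. ?d i) = 0" by (intro prod_zero) auto
        then show ?thesis using False by simp
      qed
    qed
    finally have "coeff (\<Prod>i = 0..<n. char_poly_matrix C $$ (i, p i)) (n - k) =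
      (\<Sum>\<alpha>\<in>Pow ?U. if card \<alpha> = k then (if p permutes \<alpha>
        then (- 1) ^ k * (\<Prod>i\<in>\<alpha>. C $$ (i, p i)) else 0) else 0)"
    proof (simp only: coeff_sum, intro sum.cong refl)
      fix \<alpha> assume "\<alpha> \<in> Pow ?U"
      then have "card \<alpha> \<le> n" using card_mono[of ?U \<alpha>] by simp
      then have "n - card \<alpha> = n - k \<longleftrightarrow> card \<alpha> = k" using True by auto
      then show "coeff (if p permutes \<alpha>
          then monom ((- 1) ^ card \<alpha> * (\<Prod>i\<in>\<alpha>. C $$ (i, p i))) (n - card \<alpha>) else 0) (n - k) =
        (if card \<alpha> = k then (if p permutes \<alpha>
          then (- 1) ^ k * (\<Prod>i\<in>\<alpha>. C $$ (i, p i)) else 0) else 0)"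
        by auto
    qed
    also have "\<dots> = (\<Sum>\<alpha> | \<alpha> \<in> Pow ?U \<and> card \<alpha> = k. if p permutes \<alpha>
        then (- 1) ^ k * (\<Prod>i\<in>\<alpha>. C $$ (i, p i)) else 0)"
      by (rule sum.inter_filter[symmetric]) simp
    finally show ?thesis by simp
  qed
  have coeff_sign: "coeff (signof p * q) m = signof p * coeff q m" for p and q :: "'a poly" and m
    by (simp add: sign_def)
  have "S k C = (- 1) ^ k * (\<Sum>p | p permutes ?U. signof p *
      (\<Sum>\<alpha> | \<alpha> \<subseteq> ?U \<and> card \<alpha> = k. if p permutes \<alpha>
        then (- 1) ^ k * (\<Prod>i\<in>\<alpha>. C $$ (i, p i)) else 0))"
    using C True carrier_matD[OF M]
    by (simp add: S_def char_poly_def det_def coeff_sum coeff_sign term_coeff)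
  also have "\<dots> = (\<Sum>p | p permutes ?U. \<Sum>\<alpha> | \<alpha> \<subseteq> ?U \<and> card \<alpha> = k. if p permutes \<alpha>
        then signof p * (\<Prod>i\<in>\<alpha>. C $$ (i, p i)) else 0)"
  proof -
    have "(- 1) ^ k * (s * ((- 1) ^ k * x)) = s * x" for s x :: 'a
      by (simp add: mult.left_commute flip: power_add mult.assoc)
    then show ?thesis
      by (auto simp: sum_distrib_left intro!: sum.cong)
  qed
  also have "\<dots> = (\<Sum>\<alpha> | \<alpha> \<subseteq> ?U \<and> card \<alpha> = k. \<Sum>p | p permutes ?U. if p permutes \<alpha>
        then signof p * (\<Prod>i\<in>\<alpha>. C $$ (i, p i)) else 0)"
    by (rule sum.swap)
  also have "\<dots> = (\<Sum>\<alpha> | \<alpha> \<subseteq> ?U \<and> card \<alpha> = k.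
    \<Sum>p | p permutes \<alpha>. signof p * (\<Prod>i\<in>\<alpha>. C $$ (i, p i)))"
  proof (rule sum.cong[OF refl])
    fix \<alpha> assume "\<alpha> \<in> {\<alpha>. \<alpha> \<subseteq> ?U \<and> card \<alpha> = k}"
    then have "{p. p permutes ?U \<and> p permutes \<alpha>} = {p. p permutes \<alpha>}"
      using permutes_subset by blast
    then show "(\<Sum>p | p permutes ?U. if p permutes \<alpha>
        then signof p * (\<Prod>i\<in>\<alpha>. C $$ (i, p i)) else 0) =
      (\<Sum>p | p permutes \<alpha>. signof p * (\<Prod>i\<in>\<alpha>. C $$ (i, p i)))"
      by (simp add: finite_permutations flip: sum.inter_filter)
  qed
  finally show ?thesis .
qed

lemma sum_subsets_card_0:
  fixes F :: "nat set \<Rightarrow> 'a :: comm_monoid_add"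
  shows "(\<Sum>\<beta> | \<beta> \<subseteq> {0..<m} \<and> card \<beta> = 0. F \<beta>) = F {}"
proof -
  have "{\<beta>. \<beta> \<subseteq> {0..<m} \<and> card \<beta> = 0} = {{}}"
    using finite_subset by fastforce
  then show ?thesis by simp
qed

text \<open>Splitting off the largest element of each subset. Iterated, this turns a sum over subsets
  of a fixed size into a nested sum over increasing tuples, which is amenable to induction on
  \<open>n\<close>.\<close>

lemma sum_subsets_card_Suc:
  fixes F :: "nat set \<Rightarrow> 'a :: comm_monoid_add"
  shows "(\<Sum>\<alpha> | \<alpha> \<subseteq> {0..<n} \<and> card \<alpha> = Suc k. F \<alpha>)
    = (\<Sum>m<n. \<Sum>\<beta> | \<beta> \<subseteq> {0..<m} \<and> card \<beta> = k. F (insert m \<beta>))"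
proof (induction n)
  case 0
  then show ?case by (auto intro!: sum.neutral)
next
  case (Suc n)
  let ?old = "{\<alpha>. \<alpha> \<subseteq> {0..<n} \<and> card \<alpha> = Suc k}"
  let ?new = "{\<beta>. \<beta> \<subseteq> {0..<n} \<and> card \<beta> = k}"
  have fin: "finite \<beta>" "n \<notin> \<beta>" if "\<beta> \<subseteq> {0..<n}" for \<beta>
    using that finite_subset by auto
  have split: "{\<alpha>. \<alpha> \<subseteq> {0..<Suc n} \<and> card \<alpha> = Suc k} = ?old \<union> insert n ` ?new"
  proof (intro equalityI subsetI)
    fix \<alpha> assume a: "\<alpha> \<in> {\<alpha>. \<alpha> \<subseteq> {0..<Suc n} \<and> card \<alpha> = Suc k}"
    show "\<alpha> \<in> ?old \<union> insert n ` ?new"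
    proof (cases "n \<in> \<alpha>")
      case True
      then have "\<alpha> = insert n (\<alpha> - {n})" by blast
      moreover have "\<alpha> - {n} \<in> ?new" using a True by (auto simp: less_Suc_eq)
      ultimately show ?thesis by blast
    qed (use a in \<open>auto simp: less_Suc_eq\<close>)
  qed (auto simp: fin)
  have "(\<Sum>\<alpha> | \<alpha> \<subseteq> {0..<Suc n} \<and> card \<alpha> = Suc k. F \<alpha>) = sum F ?old + sum F (insert n ` ?new)"
    unfolding split by (rule sum.union_disjoint) auto
  also have "sum F (insert n ` ?new) = (\<Sum>\<beta>\<in>?new. F (insert n \<beta>))"
    by (subst sum.reindex) (auto intro!: inj_onI simp: fin dest: insert_ident[THEN iffD1, rotated 2])
  finally show ?case using Suc.IH by simp
qed

lemma S_1_eq_sum: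
  assumes C: "C \<in> carrier_mat n n"
  shows "S 1 C = (\<Sum>i<n. C $$ (i, i))"
  unfolding S_eq_sum_principal_minors[OF C] One_nat_def sum_subsets_card_Suc sum_subsets_card_0
  by simp

lemma S_2_eq_sum:
  assumes C: "C \<in> carrier_mat n n"
  shows "S 2 C = (\<Sum>j<n. \<Sum>i<j. C $$ (i, i) * C $$ (j, j) - C $$ (i, j) * C $$ (j, i))"
proof -
  have minor: "(\<Sum>p | p permutes {j, i}. signof p * (\<Prod>x\<in>{j, i}. C $$ (x, p x)))
      = C $$ (i, i) * C $$ (j, j) - C $$ (i, j) * C $$ (j, i)" if "i < j" for i j
    using that by (subst sum_over_permutations_insert) (simp_all add: sign_swap_id algebra_simps)
  show ?thesis
    unfolding S_eq_sum_principal_minors[OF C] numeral_2_eq_2 sum_subsets_card_Suc sum_subsets_card_0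
    by (auto intro!: sum.cong simp: minor simp del: prod.insert)
qed

text \<open>The determinant of the columns \<open>i\<close>, \<open>j\<close>, \<open>k\<close> of the matrix with rows \<open>u\<close>, \<open>v\<close>, \<open>w\<close>.
  Row functions are separate arguments so that rows of different matrices can be mixed, as
  happens when a principal minor of a sum of matrices is expanded.\<close>

definition det3 :: "(nat \<Rightarrow> 'a) \<Rightarrow> (nat \<Rightarrow> 'a) \<Rightarrow> (nat \<Rightarrow> 'a) \<Rightarrow> nat \<Rightarrow> nat \<Rightarrow> nat \<Rightarrow> 'a :: comm_ring_1"
  where "det3 u v w i j k = u i * (v j * w k - v k * w j) - u j * (v i * w k - v k * w i)
    + u k * (v i * w j - v j * w i)"

lemma S_3_eq_sum:
  assumes C: "C \<in> carrier_mat n n"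
  shows "S 3 C = (\<Sum>k<n. \<Sum>j<k. \<Sum>i<j.
    det3 (\<lambda>x. C $$ (i, x)) (\<lambda>x. C $$ (j, x)) (\<lambda>x. C $$ (k, x)) i j k)"
proof -
  have minor: "(\<Sum>p | p permutes {k, j, i}. signof p * (\<Prod>x\<in>{k, j, i}. C $$ (x, p x)))
      = det3 (\<lambda>x. C $$ (i, x)) (\<lambda>x. C $$ (j, x)) (\<lambda>x. C $$ (k, x)) i j k"
    if "i < j" "j < k" for i j k
  proof -
    have f: "finite {j, i}" "k \<notin> {j, i}" "finite {i}" "j \<notin> {i}" using that by auto
    show ?thesis
      unfolding sum_over_permutations_insert[OF f(1,2)] sum_over_permutations_insert[OF f(3,4)]
        permutes_sing det3_def
      using that
      by (simp add: sign_swap_id permutation_swap_id sign_compose transpose_def algebra_simps)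
  qed
  show ?thesis
    unfolding S_eq_sum_principal_minors[OF C] numeral_3_eq_3 sum_subsets_card_Suc sum_subsets_card_0
    by (auto intro!: sum.cong simp: minor simp del: prod.insert)
qed

section \<open>From ordered to unrestricted index tuples\<close>

text \<open>Cross terms of \<open>S 2\<close> come as \<open>f i j + f j i\<close> over pairs \<open>i < j\<close>, while traces and
  their products are sums over unrestricted indices. The two differ by the diagonal terms
  \<open>f i i\<close> only; for \<open>f i j = a i i * b j j - a i j * b j i\<close> these are zero.\<close>

lemma sum_pairs_symmetrize:
  fixes f :: "nat \<Rightarrow> nat \<Rightarrow> 'a :: comm_monoid_add"
  assumes "\<And>i. f i i = 0"
  shows "(\<Sum>j<n. \<Sum>i<j. f i j + f j i) = (\<Sum>i<n. \<Sum>j<n. f i j)"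
  by (induction n) (simp_all add: assms sum.distrib ac_simps)

text \<open>The analogue for \<open>S 3\<close>. Think of \<open>N p q r\<close> as the minor on \<open>{p, q, r}\<close> whose row \<open>p\<close>
  is taken from another matrix: it is symmetric in \<open>q\<close> and \<open>r\<close>, and it vanishes when the
  distinguished index \<open>p\<close> coincides with one of the others, since two columns agree. Hence the
  distinguished index may run freely over all values, and only \<open>q < r\<close> stays ordered.\<close>

lemma sum_triples_distinguish:
  fixes N :: "nat \<Rightarrow> nat \<Rightarrow> nat \<Rightarrow> 'a :: comm_monoid_add"
  assumes sym: "\<And>p q r. N p q r = N p r q" and zero: "\<And>p q. N p p q = 0"
  shows "(\<Sum>k<n. \<Sum>j<k. \<Sum>i<j. N i j k + N j i k + N k i j) = (\<Sum>p<n. \<Sum>k<n. \<Sum>j<k. N p j k)"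
proof (induction n)
  case (Suc n)
  have zero': "N n j n = 0" for j using sym zero by metis
  have pairs: "(\<Sum>j<n. \<Sum>i<j. N i j n + N j i n) = (\<Sum>p<n. \<Sum>j<n. N p j n)"
    by (rule sum_pairs_symmetrize) (rule zero)
  have "(\<Sum>k<Suc n. \<Sum>j<k. \<Sum>i<j. N i j k + N j i k + N k i j)
      = (\<Sum>k<n. \<Sum>j<k. \<Sum>i<j. N i j k + N j i k + N k i j)
        + ((\<Sum>j<n. \<Sum>i<j. N i j n + N j i n) + (\<Sum>j<n. \<Sum>i<j. N n i j))"
    by (simp add: sum.distrib ac_simps)
  then show ?case
    unfolding Suc.IH pairs by (simp add: sum.distrib zero' ac_simps)
qed simp

text \<open>Laplace expansion along the row of \<open>b\<close>. The diagonal entry \<open>b p p\<close> is multiplied by a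
  principal \<open>2 \<times> 2\<close> minor of \<open>a\<close>. The other terms pair up under exchange of \<open>q\<close> and \<open>r\<close> and so
  become sums over independent \<open>q\<close> and \<open>r\<close>: the diagonal contributions \<open>q = r\<close> of the two kinds
  of terms, \<open>b p q * a q q * a q p\<close>, cancel each other. In terms of traces the value is
  \<open>tr b * S 2 a - tr a * tr (b a) + tr (b a a)\<close>.\<close>

lemma sum_det3_row:
  fixes a b :: "nat \<Rightarrow> nat \<Rightarrow> 'a :: comm_ring_1"
  shows "(\<Sum>p<n. \<Sum>r<n. \<Sum>q<r. det3 (b p) (a q) (a r) p q r)
    = (\<Sum>p<n. b p p) * (\<Sum>r<n. \<Sum>q<r. a q q * a r r - a q r * a r q)
      - (\<Sum>r<n. a r r) * (\<Sum>p<n. \<Sum>q<n. b p q * a q p)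
      + (\<Sum>p<n. \<Sum>q<n. b p q * (\<Sum>r<n. a q r * a r p))"
proof -
  let ?f = "\<lambda>p q r. b p q * (a q r * a r p) - a r r * (b p q * a q p)"
  have "det3 (b p) (a q) (a r) p q r
      = b p p * (a q q * a r r - a q r * a r q) + (?f p q r + ?f p r q)" for p q r
    by (simp add: det3_def algebra_simps)
  then have "(\<Sum>p<n. \<Sum>r<n. \<Sum>q<r. det3 (b p) (a q) (a r) p q r)
      = (\<Sum>p<n. b p p * (\<Sum>r<n. \<Sum>q<r. a q q * a r r - a q r * a r q))
        + (\<Sum>p<n. \<Sum>r<n. \<Sum>q<r. ?f p q r + ?f p r q)"
    by (simp only: sum.distrib sum_distrib_left)
  also have "(\<Sum>p<n. \<Sum>r<n. \<Sum>q<r. ?f p q r + ?f p r q) = (\<Sum>p<n. \<Sum>q<n. \<Sum>r<n. ?f p q r)"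
    by (intro sum.cong refl sum_pairs_symmetrize) (simp add: algebra_simps)
  also have "\<dots> = (\<Sum>p<n. \<Sum>q<n. b p q * (\<Sum>r<n. a q r * a r p))
      - (\<Sum>r<n. a r r) * (\<Sum>p<n. \<Sum>q<n. b p q * a q p)"
    by (simp add: sum_subtractf sum_distrib_left flip: sum_distrib_right)
  finally show ?thesis by (simp add: algebra_simps flip: sum_distrib_right)
qed

section \<open>Polarization of the second and third symmetric function\<close>

lemma S_1_mult_eq_sum:
  assumes "A \<in> carrier_mat n n" "B \<in> carrier_mat n n"
  shows "S 1 (A * B) = (\<Sum>i<n. \<Sum>j<n. A $$ (i, j) * B $$ (j, i))"
  using assms
  by (simp add: S_1_eq_sum[of _ n] scalar_prod_def atLeast0LessThan del: One_nat_def)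

lemma S_1_mult_commute:
  assumes "A \<in> carrier_mat n n" "B \<in> carrier_mat n n"
  shows "S 1 (A * B) = S 1 (B * A)"
  unfolding S_1_mult_eq_sum[OF assms] S_1_mult_eq_sum[OF assms(2,1)]
  by (subst sum.swap) (simp add: mult.commute)

lemma S_1_add:
  assumes "A \<in> carrier_mat n n" "B \<in> carrier_mat n n"
  shows "S 1 (A + B) = S 1 A + S 1 B"
  using assms by (simp add: S_1_eq_sum[of _ n] sum.distrib del: One_nat_def)

lemma S_2_add:
  assumes A: "A \<in> carrier_mat n n" and B: "B \<in> carrier_mat n n"
  shows "S 2 (A + B) = S 2 A + S 2 B + S 1 A * S 1 B - S 1 (A * B)"
proof -
  let ?f = "\<lambda>i j. A $$ (i, i) * B $$ (j, j) - A $$ (i, j) * B $$ (j, i)"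
  have "S 2 (A + B) = (\<Sum>j<n. \<Sum>i<j.
      (A $$ (i, i) * A $$ (j, j) - A $$ (i, j) * A $$ (j, i))
      + (B $$ (i, i) * B $$ (j, j) - B $$ (i, j) * B $$ (j, i)) + (?f i j + ?f j i))"
    unfolding S_2_eq_sum[OF add_carrier_mat[OF B]] using A B
    by (intro sum.cong refl) (simp add: algebra_simps)
  also have "\<dots> = S 2 A + S 2 B + (\<Sum>j<n. \<Sum>i<j. ?f i j + ?f j i)"
    by (simp only: sum.distrib S_2_eq_sum[OF A] S_2_eq_sum[OF B])
  also have "(\<Sum>j<n. \<Sum>i<j. ?f i j + ?f j i) = (\<Sum>i<n. \<Sum>j<n. ?f i j)"
    by (rule sum_pairs_symmetrize) simp
  also have "\<dots> = S 1 A * S 1 B - S 1 (A * B)"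
    by (simp add: S_1_eq_sum[OF A] S_1_eq_sum[OF B] S_1_mult_eq_sum[OF A B] sum_subtractf
        sum_product del: One_nat_def)
  finally show ?thesis by simp
qed

lemma pow_mat_2:
  assumes "A \<in> carrier_mat n n"
  shows "A ^\<^sub>m 2 = A * A"
  using assms by (simp add: numeral_2_eq_2)

text \<open>The part of \<open>S 3 (A + B)\<close> that is quadratic in \<open>A\<close> and linear in \<open>B\<close>; exchanging the two
  matrices gives the other mixed part.\<close>

lemma S_3_cross_term:
  assumes A: "A \<in> carrier_mat n n" and B: "B \<in> carrier_mat n n"
  shows "(\<Sum>p<n. \<Sum>r<n. \<Sum>q<r.
      det3 (\<lambda>x. B $$ (p, x)) (\<lambda>x. A $$ (q, x)) (\<lambda>x. A $$ (r, x)) p q r)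
    = S 1 B * S 2 A - S 1 A * S 1 (A * B) + S 1 (A ^\<^sub>m 2 * B)"
proof -
  have "S 1 (A ^\<^sub>m 2 * B) = S 1 (B * (A * A))"
    using S_1_mult_commute[of "A * A" n B] A B by (simp add: pow_mat_2[OF A])
  also have "\<dots> = (\<Sum>p<n. \<Sum>q<n. B $$ (p, q) * (\<Sum>r<n. A $$ (q, r) * A $$ (r, p)))"
    using A B
    by (simp add: S_1_mult_eq_sum[of _ n] scalar_prod_def atLeast0LessThan del: One_nat_def)
  finally show ?thesis
    by (simp add: sum_det3_row S_1_eq_sum[OF A] S_1_eq_sum[OF B] S_2_eq_sum[OF A]
        S_1_mult_commute[OF A B] S_1_mult_eq_sum[OF B A] del: One_nat_def)
qed

text \<open>By multilinearity in the rows, each \<open>3 \<times> 3\<close> minor of \<open>A + B\<close> is the sum of the minors of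
  \<open>A\<close> and of \<open>B\<close> and of six mixed ones, three with a single row from \<open>B\<close> and three with a single
  row from \<open>A\<close>. Moving the single row to the front, by a simultaneous permutation of rows and
  columns, leaves the sign unchanged and brings both groups into the form of the distinguished
  row.\<close>

lemma S_3_add:
  assumes A: "A \<in> carrier_mat n n" and B: "B \<in> carrier_mat n n"
  shows "S 3 (A + B) = S 3 A + S 3 B - S 1 (A + B) * S 1 (A * B)
    + S 1 A * S 2 B + S 1 B * S 2 A + S 1 (A ^\<^sub>m 2 * B) + S 1 (A * B ^\<^sub>m 2)"
proof -
  define a where "a i = (\<lambda>x. A $$ (i, x))" for i
  define b where "b i = (\<lambda>x. B $$ (i, x))" for i
  let ?N = "\<lambda>u v p q r. det3 (u p) (v q) (v r) p q r"
  have cross: "(\<Sum>k<n. \<Sum>j<k. \<Sum>i<j. ?N u v i j k + ?N u v j i k + ?N u v k i j)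
      = (\<Sum>p<n. \<Sum>r<n. \<Sum>q<r. ?N u v p q r)" for u v :: "nat \<Rightarrow> nat \<Rightarrow> 'a"
    by (rule sum_triples_distinguish) (simp_all add: det3_def algebra_simps)
  have "S 3 (A + B) = (\<Sum>k<n. \<Sum>j<k. \<Sum>i<j.
      det3 (a i) (a j) (a k) i j k + det3 (b i) (b j) (b k) i j k
      + (?N b a i j k + ?N b a j i k + ?N b a k i j)
      + (?N a b i j k + ?N a b j i k + ?N a b k i j))"
    unfolding S_3_eq_sum[OF add_carrier_mat[OF B]] using A B
    by (intro sum.cong refl) (simp add: a_def b_def det3_def algebra_simps)
  also have "\<dots> = S 3 A + S 3 B
      + (\<Sum>p<n. \<Sum>r<n. \<Sum>q<r. ?N b a p q r) + (\<Sum>p<n. \<Sum>r<n. \<Sum>q<r. ?N a b p q r)"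
    unfolding cross[symmetric] S_3_eq_sum[OF A] S_3_eq_sum[OF B]
    by (simp only: sum.distrib a_def b_def)
  also have "\<dots> = S 3 A + S 3 B
      + (S 1 B * S 2 A - S 1 A * S 1 (A * B) + S 1 (A ^\<^sub>m 2 * B))
      + (S 1 A * S 2 B - S 1 B * S 1 (B * A) + S 1 (B ^\<^sub>m 2 * A))"
    unfolding a_def b_def S_3_cross_term[OF A B] S_3_cross_term[OF B A] ..
  also have "S 1 (B * A) = S 1 (A * B)"
    by (rule S_1_mult_commute[OF B A])
  also have "S 1 (B ^\<^sub>m 2 * A) = S 1 (A * B ^\<^sub>m 2)"
    by (rule S_1_mult_commute[OF pow_carrier_mat[OF B] A])
  finally show ?thesis
    by (simp add: S_1_add[OF A B] algebra_simps del: One_nat_def)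
qed

text \<open>Two applications of the formula for two summands, to \<open>(A + B) + C\<close> and to \<open>A + B\<close>. The
  term \<open>S 1 A * S 1 B * S 1 C\<close> arises from \<open>S 1 C * S 2 (A + B)\<close>, and the two traces of products
  of all three matrices come from the mixed products in \<open>(A + B) ^\<^sub>m 2 * C\<close>.\<close>

lemma S_3_add_add:
  assumes A: "A \<in> carrier_mat n n" and B: "B \<in> carrier_mat n n" and C: "C \<in> carrier_mat n n"
  shows "S 3 (A + B + C) = S 3 A + S 3 B + S 3 C
    - S 1 (A + B + C) * S 1 (A * B + A * C + B * C)
    + S 1 A * (S 2 B + S 2 C) + S 1 B * (S 2 A + S 2 C) + S 1 C * (S 2 A + S 2 B)
    + S 1 A * S 1 B * S 1 C
    + S 1 (A ^\<^sub>m 2 * B) + S 1 (A * B ^\<^sub>m 2)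
    + S 1 (A ^\<^sub>m 2 * C) + S 1 (A * C ^\<^sub>m 2)
    + S 1 (B ^\<^sub>m 2 * C) + S 1 (B * C ^\<^sub>m 2)
    + S 1 (A * B * C) + S 1 (A * C * B)"
proof -
  have "(A + B) ^\<^sub>m 2 = A * A + B * A + (A * B + B * B)"
    using A B by (simp add: pow_mat_2[of _ n] add_mult_distrib_mat[of _ n n] mult_add_distrib_mat[of _ n n])
  then have "(A + B) ^\<^sub>m 2 * C = A * A * C + B * A * C + (A * B * C + B * B * C)"
    using A B C by (simp add: add_mult_distrib_mat[of _ n n])
  then have "S 1 ((A + B) ^\<^sub>m 2 * C)
      = S 1 (A ^\<^sub>m 2 * C) + S 1 (B * (A * C)) + (S 1 (A * B * C) + S 1 (B ^\<^sub>m 2 * C))"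
    using A B C by (simp add: S_1_add[of _ n] pow_mat_2[of _ n] assoc_mult_mat[of _ n n] del: One_nat_def)
  also have "S 1 (B * (A * C)) = S 1 (A * C * B)"
    by (rule S_1_mult_commute[OF B mult_carrier_mat[OF A C]])
  finally have square: "S 1 ((A + B) ^\<^sub>m 2 * C)
      = S 1 (A ^\<^sub>m 2 * C) + S 1 (B ^\<^sub>m 2 * C) + S 1 (A * B * C) + S 1 (A * C * B)"
    by (simp add: ac_simps)
  have AB: "A + B \<in> carrier_mat n n" using B by simp
  have 1: "S 1 (A + B + C) = S 1 A + S 1 B + S 1 C"
    by (simp only: S_1_add[OF AB C] S_1_add[OF A B])
  have 2: "S 1 (A * B + A * C + B * C) = S 1 (A * B) + S 1 (A * C) + S 1 (B * C)"
    using A B C by (simp add: S_1_add[of _ n] del: One_nat_def)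
  have 3: "S 1 ((A + B) * C) = S 1 (A * C) + S 1 (B * C)"
    using A B C by (simp add: S_1_add[of _ n] add_mult_distrib_mat[of _ n n] del: One_nat_def)
  have 4: "S 1 ((A + B) * C ^\<^sub>m 2) = S 1 (A * C ^\<^sub>m 2) + S 1 (B * C ^\<^sub>m 2)"
    using S_1_add[OF mult_carrier_mat[OF A pow_carrier_mat[OF C]]
        mult_carrier_mat[OF B pow_carrier_mat[OF C]]]
    unfolding add_mult_distrib_mat[OF A B pow_carrier_mat[OF C]] .
  show ?thesis
    unfolding S_3_add[OF AB C] square 1 2 3 4 S_3_add[OF A B] S_2_add[OF A B] S_1_add[OF A B]
    by (simp only: algebra_simps)
qed

theorem lemma3p2:
  fixes A1 A2 A3 :: "'a :: field mat" and n :: nat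
  assumes "0 < n"
    and "A1 \<in> carrier_mat n n"
    and "A2 \<in> carrier_mat n n"
    and "A3 \<in> carrier_mat n n"
  shows "S 2 (A1 + A2) = S 2 A1 + S 2 A2 + S 1 A1 * S 1 A2 - S 1 (A1 * A2)
    \<and> S 3 (A1 + A2) =
           S 3 A1 + S 3 A2 - S 1 (A1 + A2) * S 1 (A1 * A2)
           + S 1 A1 * S 2 A2 + S 1 A2 * S 2 A1
           + S 1 (A1 ^\<^sub>m 2 * A2) + S 1 (A1 * A2 ^\<^sub>m 2)
    \<and> S 3 (A1 + A2 + A3) =
           S 3 A1 + S 3 A2 + S 3 A3
           - S 1 (A1 + A2 + A3) * S 1 (A1 * A2 + A1 * A3 + A2 * A3)
           + S 1 A1 * (S 2 A2 + S 2 A3)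
           + S 1 A2 * (S 2 A1 + S 2 A3)
           + S 1 A3 * (S 2 A1 + S 2 A2)
           + S 1 A1 * S 1 A2 * S 1 A3
           + S 1 (A1 ^\<^sub>m 2 * A2) + S 1 (A1 * A2 ^\<^sub>m 2)
           + S 1 (A1 ^\<^sub>m 2 * A3) + S 1 (A1 * A3 ^\<^sub>m 2)
           + S 1 (A2 ^\<^sub>m 2 * A3) + S 1 (A2 * A3 ^\<^sub>m 2)
           + S 1 (A1 * A2 * A3) + S 1 (A1 * A3 * A2)"
  using S_2_add[OF assms(2,3)] S_3_add[OF assms(2,3)] S_3_add_add[OF assms(2-4)] by blast

end
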